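(* Let $T>0$ and let $H:[0,T]\times\mathbb{R}\to(0,1)$ be a Lipschitz-Hölder response function with temporal Hölder exponent $\gamma$. Suppose the Responsive Fractional Brownian Motion $\{X_t\}_{t\in[0,T]}$ with response function $H$ has sample paths that are almost surely $\gamma^*$-Hölder continuous on $[0,T]$ for some $\gamma^*>0$. Then the instantaneous scaling exponent process $\alpha(t,\omega):=H(t,X_t(\omega))$ satisfies, almost surely, $$|\alpha(t,\omega)-\alpha(s,\omega)|\le M(\omega)|t-s|^{\gamma_h}\qquad\forall\,t,s\in[0,T],$$ where $\gamma_h=\min(\gamma,\gamma^* )$ and $M(\omega)$ is an almost surely finite random variable.
   Context: Lipschitz-Hölder response function: $H:[0,T]\times\mathbb{R}\to(0,1)$ such that there are constants $L_H>0$, $C_H>0$, $\gamma\in(0,1]$, $0<h_{\min}\le h_{\max}<1$ with, for all $t,s\in[0,T]$, $x,y\in\mathbb{R}$: (i) $|H(t,x)-H(t,y)|\le L_H|x-y|$; (ii) $|H(t,x)-H(s,x)|\le C_H|t-s|^\gamma$; (iii) $h_{\min}\le H(t,x)\le h_{\max}$. Responsive Fractional Brownian Motion (RfBm) with response function $H$: on a filtered probability space $(\Omega,\mathcal{F},(\mathcal{F}_t)_{t\in[0,T]},\mathbb{P})$ satisfying the usual conditions with a standard $(\mathcal{F}_t)$-Brownian motion $B$, an $(\mathcal{F}_t)$-adapted process $\{X_t\}_{t\in[0,T]}$ with almost surely continuous paths such that for each $t\in[0,T]$ the Itô integral below is well-defined and, $\mathbb{P}$-almost surely, $$X_t=\int_0^t\sqrt{2H(s,X_s)}\,(t-s)^{H(s,X_s)-1/2}\,dB(s).$$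 Almost sure $\gamma^*$-Hölder continuity means: for almost every $\omega$ there is $C(\omega)<\infty$ with $|X_t(\omega)-X_s(\omega)|\le C(\omega)|t-s|^{\gamma^*}$ for all $t,s\in[0,T]$. *)

theory Defs
  imports "HOL-Probability.Probability"
begin

section \<open>Response functions\<close>

text \<open>Functions on \<open>[0,T]\<close> are total functions on the reals, constrained only on \<open>{0..T}\<close>.\<close>

definition lipschitz_holder_response :: "real \<Rightarrow> (real \<Rightarrow> real \<Rightarrow> real) \<Rightarrow> real \<Rightarrow> bool" where
  "lipschitz_holder_response T H \<gamma> \<longleftrightarrow>
     (\<forall>t\<in>{0..T}. \<forall>x. H t x \<in> {0<..<1}) \<and>
     0 < \<gamma> \<and> \<gamma> \<le> 1 \<and>
     (\<exists>L C h_min h_max.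
        L > 0 \<and> C > 0 \<and> 0 < h_min \<and> h_min \<le> h_max \<and> h_max < 1 \<and>
        (\<forall>t\<in>{0..T}. \<forall>x y. \<bar>H t x - H t y\<bar> \<le> L * \<bar>x - y\<bar>) \<and>
        (\<forall>t\<in>{0..T}. \<forall>s\<in>{0..T}. \<forall>x. \<bar>H t x - H s x\<bar> \<le> C * \<bar>t - s\<bar> powr \<gamma>) \<and>
        (\<forall>t\<in>{0..T}. \<forall>x. h_min \<le> H t x \<and> H t x \<le> h_max))"


section \<open>Filtrations, adaptedness, Brownian motion\<close>

text \<open>
  The library locale \<open>filtration\<close> is indexed by a whole type; here the index set is \<open>[0,T]\<close>.
  Of each \<open>F t\<close> only the \<open>\<sigma>\<close>-algebra matters, never its measure component.
\<close>

definition filtration_upto :: "'a measure \<Rightarrow> real \<Rightarrow> (real \<Rightarrow> 'a measure) \<Rightarrow> bool" where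
  "filtration_upto P T F \<longleftrightarrow>
     (\<forall>t\<in>{0..T}. subalgebra P (F t)) \<and>
     (\<forall>s\<in>{0..T}. \<forall>t\<in>{s..T}. subalgebra (F t) (F s))"

text \<open>The first conjunct says that \<open>F 0\<close> contains all subsets of \<open>P\<close>-null sets (so that \<open>P\<close> is
  complete as well); the second is right-continuity.\<close>

definition usual_conditions :: "'a measure \<Rightarrow> real \<Rightarrow> (real \<Rightarrow> 'a measure) \<Rightarrow> bool" where
  "usual_conditions P T F \<longleftrightarrow>
     (\<forall>N\<in>null_sets P. \<forall>A. A \<subseteq> N \<longrightarrow> A \<in> sets (F 0)) \<and>
     (\<forall>t\<in>{0..<T}. sets (F t) = (\<Inter>u\<in>{t<..T}. sets (F u)))"

definition adapted_upto :: "real \<Rightarrow> (real \<Rightarrow> 'a measure) \<Rightarrow> (real \<Rightarrow> 'a \<Rightarrow> real) \<Rightarrow> bool" where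
  "adapted_upto T F X \<longleftrightarrow> (\<forall>t\<in>{0..T}. X t \<in> borel_measurable (F t))"

definition as_continuous_upto :: "'a measure \<Rightarrow> real \<Rightarrow> (real \<Rightarrow> 'a \<Rightarrow> real) \<Rightarrow> bool" where
  "as_continuous_upto P T X \<longleftrightarrow> (AE \<omega> in P. continuous_on {0..T} (\<lambda>t. X t \<omega>))"

definition brownian_motion_upto ::
  "'a measure \<Rightarrow> real \<Rightarrow> (real \<Rightarrow> 'a measure) \<Rightarrow> (real \<Rightarrow> 'a \<Rightarrow> real) \<Rightarrow> bool" where
  "brownian_motion_upto P T F B \<longleftrightarrow>
     adapted_upto T F B \<and>
     as_continuous_upto P T B \<and>
     (AE \<omega> in P. B 0 \<omega> = 0) \<and>
     (\<forall>s\<in>{0..T}. \<forall>t\<in>{s<..T}.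
        distributed P lborel (\<lambda>\<omega>. B t \<omega> - B s \<omega>) (normal_density 0 (sqrt (t - s))) \<and>
        prob_space.indep_set P (sets (F s))
          (sets (vimage_algebra (space P) (\<lambda>\<omega>. B t \<omega> - B s \<omega>) borel)))"


section \<open>The Ito integral\<close>

text \<open>A simple integrand on \<open>[0,t]\<close> is given by a grid
  \<open>0 \<le> \<tau> 0 \<le> \<dots> \<le> \<tau> n \<le> t\<close> and bounded random variables \<open>\<xi> i\<close>, with \<open>\<xi> i\<close> measurable at
  time \<open>\<tau> i\<close>; it takes the value \<open>\<xi> i\<close> on \<open>(\<tau> i, \<tau> (i + 1)]\<close>.\<close>

definition simple_data ::
  "'a measure \<Rightarrow> (real \<Rightarrow> 'a measure) \<Rightarrow> real \<Rightarrow> nat \<Rightarrow> (nat \<Rightarrow> real) \<Rightarrow> (nat \<Rightarrow> 'a \<Rightarrow> real) \<Rightarrow> bool"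
where
  "simple_data P F t n \<tau> \<xi> \<longleftrightarrow>
     0 \<le> \<tau> 0 \<and> (\<forall>i<n. \<tau> i \<le> \<tau> (Suc i)) \<and> \<tau> n \<le> t \<and>
     (\<forall>i<n. \<xi> i \<in> borel_measurable (F (\<tau> i)) \<and> (\<exists>c. \<forall>\<omega>\<in>space P. \<bar>\<xi> i \<omega>\<bar> \<le> c))"

definition simple_process ::
  "nat \<Rightarrow> (nat \<Rightarrow> real) \<Rightarrow> (nat \<Rightarrow> 'a \<Rightarrow> real) \<Rightarrow> real \<Rightarrow> 'a \<Rightarrow> real" where
  "simple_process n \<tau> \<xi> s \<omega> = (\<Sum>i<n. \<xi> i \<omega> * indicator {\<tau> i<..\<tau> (Suc i)} s)"

definition simple_integral ::
  "(real \<Rightarrow> 'a \<Rightarrow> real) \<Rightarrow> nat \<Rightarrow> (nat \<Rightarrow> real) \<Rightarrow> (nat \<Rightarrow> 'a \<Rightarrow> real) \<Rightarrow> 'a \<Rightarrow> real" where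
  "simple_integral B n \<tau> \<xi> \<omega> = (\<Sum>i<n. \<xi> i \<omega> * (B (\<tau> (Suc i)) \<omega> - B (\<tau> i) \<omega>))"

definition progressive_upto :: "real \<Rightarrow> (real \<Rightarrow> 'a measure) \<Rightarrow> (real \<Rightarrow> 'a \<Rightarrow> real) \<Rightarrow> bool" where
  "progressive_upto t F g \<longleftrightarrow>
     (\<forall>u\<in>{0..t}. (\<lambda>(s, \<omega>). g s \<omega>) \<in> borel_measurable (restrict_space borel {0..u} \<Otimes>\<^sub>M F u))"

text \<open>The squared norm of \<open>L\<^sup>2([0,t] \<times> \<Omega>)\<close>, i.e. the expectation of the time integral of \<open>g\<^sup>2\<close>.\<close>

definition sq_norm_upto :: "'a measure \<Rightarrow> real \<Rightarrow> (real \<Rightarrow> 'a \<Rightarrow> real) \<Rightarrow> ennreal" where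
  "sq_norm_upto P t g =
     (\<integral>\<^sup>+\<omega>. (\<integral>\<^sup>+s\<in>{0..t}. ennreal ((g s \<omega>)\<^sup>2) \<partial>lborel) \<partial>P)"

text \<open>
  \<open>has_ito_integral P F B t f I\<close>: the integral of \<open>f\<close> over \<open>[0,t]\<close> against \<open>B\<close> is well-defined
  (\<open>f\<close> is progressively measurable and square-integrable) and \<open>I\<close> is a version of it, namely the
  \<open>L\<^sup>2(P)\<close>-limit of the integrals of simple integrands that converge to \<open>f\<close> in
  \<open>L\<^sup>2([0,t] \<times> \<Omega>)\<close>.  As usual, the integrand only matters up to indistinguishability; hence the
  process \<open>g\<close> below.  This is needed for integrands built from processes whose paths are
  continuous only almost surely, since those need not be jointly measurable on the
  exceptional null set.
\<close>

definition has_ito_integral ::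
  "'a measure \<Rightarrow> (real \<Rightarrow> 'a measure) \<Rightarrow> (real \<Rightarrow> 'a \<Rightarrow> real) \<Rightarrow> real \<Rightarrow>
   (real \<Rightarrow> 'a \<Rightarrow> real) \<Rightarrow> ('a \<Rightarrow> real) \<Rightarrow> bool" where
  "has_ito_integral P F B t f I \<longleftrightarrow>
     I \<in> borel_measurable P \<and>
     (\<exists>g. progressive_upto t F g \<and> sq_norm_upto P t g < \<infinity> \<and>
        (AE \<omega> in P. \<forall>s\<in>{0..t}. f s \<omega> = g s \<omega>) \<and>
        (\<exists>n \<tau> \<xi>.
           (\<forall>k. simple_data P F t (n k) (\<tau> k) (\<xi> k)) \<and>
           (\<lambda>k. sq_norm_upto P t (\<lambda>s \<omega>. g s \<omega> - simple_process (n k) (\<tau> k) (\<xi> k) s \<omega>))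
             \<longlonglongrightarrow> 0 \<and>
           (\<lambda>k. \<integral>\<^sup>+\<omega>. ennreal ((I \<omega> - simple_integral B (n k) (\<tau> k) (\<xi> k) \<omega>)\<^sup>2) \<partial>P)
             \<longlonglongrightarrow> 0))"


section \<open>Responsive fractional Brownian motion\<close>

text \<open>At the endpoint \<open>s = t\<close> the kernel takes the value \<open>0\<close> because \<open>0 powr a = 0\<close>; a single
  time point does not affect the integral.\<close>

definition rfbm_kernel ::
  "(real \<Rightarrow> real \<Rightarrow> real) \<Rightarrow> (real \<Rightarrow> 'a \<Rightarrow> real) \<Rightarrow> real \<Rightarrow> real \<Rightarrow> 'a \<Rightarrow> real" where
  "rfbm_kernel H X t s \<omega> = sqrt (2 * H s (X s \<omega>)) * (t - s) powr (H s (X s \<omega>) - 1/2)"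

definition responsive_fbm ::
  "'a measure \<Rightarrow> real \<Rightarrow> (real \<Rightarrow> 'a measure) \<Rightarrow> (real \<Rightarrow> 'a \<Rightarrow> real) \<Rightarrow>
   (real \<Rightarrow> real \<Rightarrow> real) \<Rightarrow> (real \<Rightarrow> 'a \<Rightarrow> real) \<Rightarrow> bool" where
  "responsive_fbm P T F B H X \<longleftrightarrow>
     prob_space P \<and> filtration_upto P T F \<and> usual_conditions P T F \<and>
     brownian_motion_upto P T F B \<and>
     adapted_upto T F X \<and> as_continuous_upto P T X \<and>
     (\<forall>t\<in>{0..T}. \<exists>I. has_ito_integral P F B t (rfbm_kernel H X t) I \<and> (AE \<omega> in P. X t \<omega> = I \<omega>))"

definition as_holder_upto ::
  "'a measure \<Rightarrow> real \<Rightarrow> (real \<Rightarrow> 'a \<Rightarrow> real) \<Rightarrow> real \<Rightarrow> bool" where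
  "as_holder_upto P T X \<beta> \<longleftrightarrow>
     (AE \<omega> in P. \<exists>C. \<forall>t\<in>{0..T}. \<forall>s\<in>{0..T}. \<bar>X t \<omega> - X s \<omega>\<bar> \<le> C * \<bar>t - s\<bar> powr \<beta>)"

definition scaling_exponent ::
  "(real \<Rightarrow> real \<Rightarrow> real) \<Rightarrow> (real \<Rightarrow> 'a \<Rightarrow> real) \<Rightarrow> real \<Rightarrow> 'a \<Rightarrow> real" where
  "scaling_exponent H X t \<omega> = H t (X t \<omega>)"

end

theory Submission
  imports Defs
begin

text \<open>
  For a fixed path the bound is elementary.  Splitting the increment of the exponent as
  \<open>H t (X t) - H s (X s) = (H t (X t) - H t (X s)) + (H t (X s) - H s (X s))\<close>, the Lipschitz
  condition bounds the first part by \<open>L * C * \<bar>t - s\<bar> powr \<gamma>'\<close>, where \<open>C\<close> is a Hoelder constant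
  of the path, and the temporal condition bounds the second by a multiple of
  \<open>\<bar>t - s\<bar> powr \<gamma>\<close>.  As \<open>[0,T]\<close> is bounded, both powers are dominated by a multiple of the power
  with the smaller exponent (\<open>powr_le_smaller_exponent\<close>).

  What remains is the measurability of the random constant, since the Hoelder constant of the path
  is only known to exist separately for each \<open>\<omega>\<close>.  A measurable choice is the supremum of the
  difference quotients over rational times, a countable supremum of random variables; because
  Hoelder paths are continuous, it controls the increments at all times
  (\<open>measurable_holder_constant\<close>).
\<close>

lemma powr_le_smaller_exponent:
  fixes r T a b :: real
  assumes "0 \<le> r" "r \<le> T" "b \<le> a"
  shows "r powr a \<le> T powr (a - b) * r powr b"
proof -
  have "r powr a = r powr (a - b) * r powr b"
    by (simp add: powr_add [symmetric])
  also have "\<dots> \<le> T powr (a - b) * r powr b"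
    using assms by (intro mult_right_mono powr_mono2) auto
  finally show ?thesis .
qed

lemma continuous_on_holder:
  fixes f :: "real \<Rightarrow> real"
  assumes "\<beta> > 0" and holder: "\<And>t s. t \<in> S \<Longrightarrow> s \<in> S \<Longrightarrow> \<bar>f t - f s\<bar> \<le> C * \<bar>t - s\<bar> powr \<beta>"
  shows "continuous_on S f"
  unfolding continuous_on_def
proof
  fix s assume s: "s \<in> S"
  have "((\<lambda>t. \<bar>t - s\<bar> powr \<beta>) \<longlongrightarrow> \<bar>s - s\<bar> powr \<beta>) (at s within S)"
    using \<open>\<beta> > 0\<close> by (intro tendsto_powr' tendsto_intros) auto
  then have "((\<lambda>t. C * \<bar>t - s\<bar> powr \<beta>) \<longlongrightarrow> 0) (at s within S)"
    by (auto intro: tendsto_mult_right_zero)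
  then have "((\<lambda>t. f t - f s) \<longlongrightarrow> 0) (at s within S)"
    by (rule Lim_null_comparison [rotated])
      (use holder s in \<open>auto simp: eventually_at_filter\<close>)
  then show "(f \<longlongrightarrow> f s) (at s within S)"
    by (rule LIM_zero_cancel)
qed

text \<open>Both sides of a Hoelder estimate are continuous in the pair of times, so the estimate passes
  from a set of times to its closure.\<close>

lemma holder_bound_on_closure:
  fixes f :: "real \<Rightarrow> real"
  assumes "\<beta> > 0" and cont: "continuous_on (closure D) f"
    and D: "\<And>t s. t \<in> D \<Longrightarrow> s \<in> D \<Longrightarrow> \<bar>f t - f s\<bar> \<le> K * \<bar>t - s\<bar> powr \<beta>"
    and "t \<in> closure D" "s \<in> closure D"
  shows "\<bar>f t - f s\<bar> \<le> K * \<bar>t - s\<bar> powr \<beta>"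
proof -
  define \<phi> where "\<phi> p = K * \<bar>fst p - snd p\<bar> powr \<beta> - \<bar>f (fst p) - f (snd p)\<bar>" for p
  have "continuous_on (closure (D \<times> D)) \<phi>"
    unfolding \<phi>_def using \<open>\<beta> > 0\<close>
    by (intro continuous_intros continuous_on_powr' continuous_on_compose2 [OF cont])
      (auto simp: closure_Times)
  moreover have "(t, s) \<in> closure (D \<times> D)"
    using assms by (simp add: closure_Times)
  ultimately have "\<phi> (t, s) \<ge> 0"
    by (rule continuous_ge_on_closure) (use D in \<open>auto simp: \<phi>_def\<close>)
  then show ?thesis
    by (simp add: \<phi>_def)
qed

text \<open>The constant is a supremum over countably many pairs of times only, which makes it measurable.
  It is formed in \<open>ennreal\<close>, because on the exceptional null set it may be infinite.\<close>

lemma measurable_holder_constant: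
  fixes X :: "real \<Rightarrow> 'a \<Rightarrow> real"
  assumes "T > 0" "\<beta> > 0"
    and meas: "\<And>t. t \<in> {0..T} \<Longrightarrow> X t \<in> borel_measurable P"
    and holder: "as_holder_upto P T X \<beta>"
  shows "\<exists>K \<in> borel_measurable P. AE \<omega> in P. \<forall>t\<in>{0..T}. \<forall>s\<in>{0..T}.
           \<bar>X t \<omega> - X s \<omega>\<bar> \<le> (K \<omega> :: real) * \<bar>t - s\<bar> powr \<beta>"
proof -
  define D where "D = {0<..<T} \<inter> \<rat>"
  have "closure D = closure {0<..<T}"
    unfolding D_def by (rule closure_open_Int_superset) (auto simp: Rats_closure_real)
  then have clD: "closure D = {0..T}"
    using \<open>T > 0\<close> by simp
  have DT: "D \<subseteq> {0..T}" and cD: "countable D"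
    by (auto simp: D_def intro: countable_rat)
  define q where "q p \<omega> = ennreal (\<bar>X (fst p) \<omega> - X (snd p) \<omega>\<bar> / \<bar>fst p - snd p\<bar> powr \<beta>)" for p \<omega>
  define S where "S \<omega> = (SUP p \<in> D \<times> D. q p \<omega>)" for \<omega>
  have "q p \<in> borel_measurable P" if "p \<in> D \<times> D" for p
  proof -
    have "X (fst p) \<in> borel_measurable P" "X (snd p) \<in> borel_measurable P"
      using that DT meas by auto
    then show ?thesis
      unfolding q_def by measurable
  qed
  then have "S \<in> borel_measurable P"
    unfolding S_def using cD by (intro borel_measurable_SUP) auto
  then have "(\<lambda>\<omega>. enn2real (S \<omega>)) \<in> borel_measurable P"
    by measurable
  moreover have "AE \<omega> in P. \<forall>t\<in>{0..T}. \<forall>s\<in>{0..T}.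
           \<bar>X t \<omega> - X s \<omega>\<bar> \<le> enn2real (S \<omega>) * \<bar>t - s\<bar> powr \<beta>"
    using holder unfolding as_holder_upto_def
  proof eventually_elim
    case (elim \<omega>)
    then obtain C where C: "\<And>t s. t \<in> {0..T} \<Longrightarrow> s \<in> {0..T} \<Longrightarrow>
        \<bar>X t \<omega> - X s \<omega>\<bar> \<le> C * \<bar>t - s\<bar> powr \<beta>"
      by blast
    have "q p \<omega> \<le> ennreal C" if "p \<in> D \<times> D" for p
    proof (cases "fst p = snd p")
      case False
      have "fst p \<in> {0..T}" "snd p \<in> {0..T}"
        using that DT by auto
      from C [OF this] False show ?thesis
        by (auto simp: q_def divide_le_eq intro!: ennreal_leI)
    qed (simp add: q_def)
    then have "S \<omega> \<le> ennreal C"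
      unfolding S_def by (intro SUP_least)
    then have fin: "S \<omega> < \<top>"
      using ennreal_less_top le_less_trans by blast
    have onD: "\<bar>X t \<omega> - X s \<omega>\<bar> \<le> enn2real (S \<omega>) * \<bar>t - s\<bar> powr \<beta>"
      if "t \<in> D" "s \<in> D" for t s
    proof (cases "t = s")
      case False
      have "q (t, s) \<omega> \<le> S \<omega>"
        unfolding S_def using that by (intro SUP_upper) auto
      then have "enn2real (q (t, s) \<omega>) \<le> enn2real (S \<omega>)"
        using fin by (rule enn2real_mono)
      then show ?thesis
        using False by (simp add: q_def divide_le_eq)
    qed simp
    have "continuous_on (closure D) (\<lambda>t. X t \<omega>)"
      unfolding clD using \<open>\<beta> > 0\<close> C by (rule continuous_on_holder)
    from holder_bound_on_closure [OF \<open>\<beta> > 0\<close> this onD] show ?case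
      unfolding clD by blast
  qed
  ultimately show ?thesis
    by (intro bexI)
qed

theorem theorem5p2:
  fixes P :: "'a measure" and T \<gamma> \<gamma>' :: real
    and F :: "real \<Rightarrow> 'a measure"
    and B X :: "real \<Rightarrow> 'a \<Rightarrow> real"
    and H :: "real \<Rightarrow> real \<Rightarrow> real"
  assumes "T > 0"
    and "lipschitz_holder_response T H \<gamma>"
    and "responsive_fbm P T F B H X"
    and "\<gamma>' > 0"
    and "as_holder_upto P T X \<gamma>'"
  shows "\<exists>M \<in> borel_measurable P. AE \<omega> in P. \<forall>t\<in>{0..T}. \<forall>s\<in>{0..T}.
           \<bar>scaling_exponent H X t \<omega> - scaling_exponent H X s \<omega>\<bar>
             \<le> (M \<omega> :: real) * \<bar>t - s\<bar> powr (min \<gamma> \<gamma>')"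
proof -
  obtain L C where L: "L > 0" and C: "C > 0"
    and lip: "\<And>t x y. t \<in> {0..T} \<Longrightarrow> \<bar>H t x - H t y\<bar> \<le> L * \<bar>x - y\<bar>"
    and hol: "\<And>t s x. t \<in> {0..T} \<Longrightarrow> s \<in> {0..T} \<Longrightarrow> \<bar>H t x - H s x\<bar> \<le> C * \<bar>t - s\<bar> powr \<gamma>"
    using assms(2) unfolding lipschitz_holder_response_def
    by (elim conjE exE) (rule that, assumption, assumption, simp_all)
  have "X t \<in> borel_measurable P" if "t \<in> {0..T}" for t
  proof (rule measurable_from_subalg)
    show "subalgebra P (F t)" "X t \<in> borel_measurable (F t)"
      using assms(3) that by (simp_all add: responsive_fbm_def filtration_upto_def adapted_upto_def)
  qed
  from measurable_holder_constant [OF \<open>T > 0\<close> \<open>\<gamma>' > 0\<close> this assms(5)]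
  obtain K where K: "K \<in> borel_measurable P"
    and AE_K: "AE \<omega> in P. \<forall>t\<in>{0..T}. \<forall>s\<in>{0..T}. \<bar>X t \<omega> - X s \<omega>\<bar> \<le> K \<omega> * \<bar>t - s\<bar> powr \<gamma>'"
    by blast
  define \<delta> where "\<delta> = min \<gamma> \<gamma>'"
  \<comment> \<open>\<open>\<bar>K \<omega>\<bar>\<close> rather than \<open>K \<omega>\<close>: lowering the exponent multiplies an inequality by the constant,
    whose sign must be known.\<close>
  define M where "M \<omega> = L * \<bar>K \<omega>\<bar> * T powr (\<gamma>' - \<delta>) + C * T powr (\<gamma> - \<delta>)" for \<omega>
  have "M \<in> borel_measurable P"
    unfolding M_def using K by measurable
  moreover have "AE \<omega> in P. \<forall>t\<in>{0..T}. \<forall>s\<in>{0..T}.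
      \<bar>scaling_exponent H X t \<omega> - scaling_exponent H X s \<omega>\<bar> \<le> M \<omega> * \<bar>t - s\<bar> powr \<delta>"
    using AE_K
  proof (eventually_elim, intro ballI)
    fix \<omega> t s
    assume XK: "\<forall>t\<in>{0..T}. \<forall>s\<in>{0..T}. \<bar>X t \<omega> - X s \<omega>\<bar> \<le> K \<omega> * \<bar>t - s\<bar> powr \<gamma>'"
      and t: "t \<in> {0..T}" and s: "s \<in> {0..T}"
    have ts: "\<bar>t - s\<bar> \<le> T"
      using t s by auto
    have "\<bar>X t \<omega> - X s \<omega>\<bar> \<le> K \<omega> * \<bar>t - s\<bar> powr \<gamma>'"
      using XK t s by blast
    also have "\<dots> \<le> \<bar>K \<omega>\<bar> * \<bar>t - s\<bar> powr \<gamma>'"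
      by (intro mult_right_mono) auto
    also have "\<dots> \<le> \<bar>K \<omega>\<bar> * (T powr (\<gamma>' - \<delta>) * \<bar>t - s\<bar> powr \<delta>)"
      using ts by (intro mult_left_mono powr_le_smaller_exponent) (auto simp: \<delta>_def)
    finally have "L * \<bar>X t \<omega> - X s \<omega>\<bar> \<le> L * (\<bar>K \<omega>\<bar> * (T powr (\<gamma>' - \<delta>) * \<bar>t - s\<bar> powr \<delta>))"
      using L by (intro mult_left_mono) auto
    with lip [OF t, of "X t \<omega>" "X s \<omega>"]
    have space: "\<bar>H t (X t \<omega>) - H t (X s \<omega>)\<bar>
        \<le> L * (\<bar>K \<omega>\<bar> * (T powr (\<gamma>' - \<delta>) * \<bar>t - s\<bar> powr \<delta>))"
      by linarith
    have "C * \<bar>t - s\<bar> powr \<gamma> \<le> C * (T powr (\<gamma> - \<delta>) * \<bar>t - s\<bar> powr \<delta>)"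
      using ts C by (intro mult_left_mono powr_le_smaller_exponent) (auto simp: \<delta>_def)
    with hol [OF t s, of "X s \<omega>"]
    have time: "\<bar>H t (X s \<omega>) - H s (X s \<omega>)\<bar> \<le> C * (T powr (\<gamma> - \<delta>) * \<bar>t - s\<bar> powr \<delta>)"
      by linarith
    have "M \<omega> * \<bar>t - s\<bar> powr \<delta> = L * (\<bar>K \<omega>\<bar> * (T powr (\<gamma>' - \<delta>) * \<bar>t - s\<bar> powr \<delta>))
        + C * (T powr (\<gamma> - \<delta>) * \<bar>t - s\<bar> powr \<delta>)"
      by (simp add: M_def algebra_simps)
    with space time
    show "\<bar>scaling_exponent H X t \<omega> - scaling_exponent H X s \<omega>\<bar> \<le> M \<omega> * \<bar>t - s\<bar> powr \<delta>"
      unfolding scaling_exponent_def by linarith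
  qed
  ultimately show ?thesis
    unfolding \<delta>_def by (intro bexI)
qed

end
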